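(* Let $\omega$ be a sub-additive weight function and let $\psi$ be a polynomial (a real polynomial, viewed as a map $\mathbb{R}\to\mathbb{R}$) of degree strictly greater than one. Let $a>2$ and $\sigma(t):=\omega(t^{1/a})$, $t\ge 0$. Then the family of iterates $\{C_{\psi_m}:\mathcal{S}_{\omega}(\mathbb{R})\to \mathcal{S}_{\sigma}(\mathbb{R}):m\in\mathbb{N}\}$ is topologizable.
   Context: A weight function is a continuous increasing function $\omega:[0,\infty)\to[0,\infty)$ such that: $(\alpha)$ there is $L\ge 1$ with $\omega(2t)\le L(\omega(t)+1)$ for all $t\ge 0$; $(\beta)$ $\int_0^\infty \frac{\omega(t)}{1+t^2}\,dt<\infty$; $(\gamma)$ $\log(1+t^2)=o(\omega(t))$ as $t\to\infty$; $(\delta)$ $\varphi_\omega(t):=\omega(e^t)$ is convex. It is sub-additive if $\omega(t_1+t_2)\le\omega(t_1)+\omega(t_2)$ for all $t_1,t_2\ge 0$. The Young conjugate is $\varphi_\omega^*(s):=\sup\{st-\varphi_\omega(t): t\ge 0\}$, $s\ge 0$. The space $\mathcal{S}_\omega(\mathbb{R})$ consists of all $f\in C^\infty(\mathbb{R})$ such that for every $\lambda>0$ $$p_{\omega,\lambda}(f):=\sup_{x\in\mathbb{R}}\sup_{n,q\in\mathbb{N}_0}(1+|x|)^q|f^{(n)}(x)|\exp\left(-\lambda\varphi_\omega^*\left(\tfrac{n+q}{\lambda}\right)\right)<\infty,$$ with the Fréchet topology given by the system of seminorms $\{p_{\omega,\lambda}:\lambda>0\}$. For a polynomial $\psi$,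 $\psi_m=\psi\circ\cdots\circ\psi$ ($m$ times), and $C_{\psi_m}f:=f\circ\psi_m$. (It is known that for $\omega$ sub-additive, $C_\psi$ maps $\mathcal{S}_\omega(\mathbb{R})$ continuously into $\mathcal{S}_{\omega(\bullet^{1/2})}(\mathbb{R})$ for every polynomial $\psi$ of degree greater than one.) For locally convex Hausdorff spaces $E,F$ with topologies determined by systems of continuous seminorms $cs(E)$, $cs(F)$ (here the systems $p_{\cdot,\lambda}$, $\lambda>0$), a family of continuous linear operators $\{T_m:E\to F: m\in\mathbb{N}\}$ is topologizable if for every $p\in cs(F)$ there is $q\in cs(E)$ such that for every $k\in\mathbb{N}$ there is $M_k>0$ with $p(T_k x)\le M_k\,q(x)$ for all $x\in E$. *)

theory Defs
  imports
    "HOL-Analysis.Analysis"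
    "HOL-Library.Landau_Symbols"
    "HOL-Computational_Algebra.Polynomial"
begin

text \<open>
  A weight function is defined on \<open>[0,\<infinity>)\<close>; it is represented by a total function on the reals
  whose values at negative arguments are irrelevant.  ``Increasing'' is understood in the weak
  sense.
\<close>

definition phi_weight :: "(real \<Rightarrow> real) \<Rightarrow> real \<Rightarrow> real" where
  "phi_weight \<omega> t = \<omega> (exp t)"

definition weight_function :: "(real \<Rightarrow> real) \<Rightarrow> bool" where
  "weight_function \<omega> \<longleftrightarrow>
     continuous_on {0..} \<omega> \<and> mono_on {0..} \<omega> \<and> (\<forall>t\<ge>0. 0 \<le> \<omega> t) \<and>
     (\<exists>L\<ge>1. \<forall>t\<ge>0. \<omega> (2 * t) \<le> L * (\<omega> t + 1)) \<and>
     (\<lambda>t. \<omega> t / (1 + t\<^sup>2)) integrable_on {0..} \<and>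
     (\<lambda>t. ln (1 + t\<^sup>2)) \<in> o[at_top](\<omega>) \<and>
     convex_on UNIV (phi_weight \<omega>)"

definition subadditive_weight :: "(real \<Rightarrow> real) \<Rightarrow> bool" where
  "subadditive_weight \<omega> \<longleftrightarrow> (\<forall>s\<ge>0. \<forall>t\<ge>0. \<omega> (s + t) \<le> \<omega> s + \<omega> t)"

text \<open>
  The supremum is a real one.  It is finite for every weight function, since the condition
  \<open>log (1 + t\<^sup>2) = o(\<omega>(t))\<close> makes \<open>phi_weight \<omega>\<close> grow faster than any linear function.
\<close>

definition young_conjugate :: "(real \<Rightarrow> real) \<Rightarrow> real \<Rightarrow> real" where
  "young_conjugate \<omega> s = (SUP t\<in>{0..}. s * t - phi_weight \<omega> t)"

text \<open>Functions are complex-valued on the real line, hence the vector derivative.\<close>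

definition nth_deriv :: "nat \<Rightarrow> (real \<Rightarrow> complex) \<Rightarrow> real \<Rightarrow> complex" where
  "nth_deriv n f = ((\<lambda>g x. vector_derivative g (at x)) ^^ n) f"

definition smooth :: "(real \<Rightarrow> complex) \<Rightarrow> bool" where
  "smooth f \<longleftrightarrow> (\<forall>n x. nth_deriv n f differentiable (at x))"

definition S_term :: "(real \<Rightarrow> real) \<Rightarrow> real \<Rightarrow> (real \<Rightarrow> complex) \<Rightarrow> real \<times> nat \<times> nat \<Rightarrow> real" where
  "S_term \<omega> l f = (\<lambda>(x, n, q). (1 + \<bar>x\<bar>) ^ q * norm (nth_deriv n f x) *
     exp (- l * young_conjugate \<omega> (real (n + q) / l)))"

definition S_space :: "(real \<Rightarrow> real) \<Rightarrow> (real \<Rightarrow> complex) set" where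
  "S_space \<omega> = {f. smooth f \<and> (\<forall>l>0. bdd_above (range (S_term \<omega> l f)))}"

definition S_seminorm :: "(real \<Rightarrow> real) \<Rightarrow> real \<Rightarrow> (real \<Rightarrow> complex) \<Rightarrow> real" where
  "S_seminorm \<omega> l f = (SUP i. S_term \<omega> l f i)"

definition S_seminorms :: "(real \<Rightarrow> real) \<Rightarrow> ((real \<Rightarrow> complex) \<Rightarrow> real) set" where
  "S_seminorms \<omega> = {S_seminorm \<omega> l | l. l > 0}"

text \<open>
  Locally convex spaces are represented as spaces \<open>E\<close> of complex-valued functions (with pointwise
  operations) together with a set \<open>P\<close> of seminorms on \<open>E\<close>; the open seminorm balls form a
  subbasis of the topology.
\<close>

definition seminorm_topology ::
    "('a \<Rightarrow> complex) set \<Rightarrow> (('a \<Rightarrow> complex) \<Rightarrow> real) set \<Rightarrow> ('a \<Rightarrow> complex) topology" where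
  "seminorm_topology E P = topology_generated_by
     {{g \<in> E. p (\<lambda>x. g x - f x) < e} | f p e. f \<in> E \<and> p \<in> P \<and> e > 0}"

definition linear_operator ::
    "('a \<Rightarrow> complex) set \<Rightarrow> ('b \<Rightarrow> complex) set \<Rightarrow> (('a \<Rightarrow> complex) \<Rightarrow> ('b \<Rightarrow> complex)) \<Rightarrow> bool" where
  "linear_operator E F T \<longleftrightarrow>
     T ` E \<subseteq> F \<and>
     (\<forall>f\<in>E. \<forall>g\<in>E. T (\<lambda>x. f x + g x) = (\<lambda>y. T f y + T g y)) \<and>
     (\<forall>c. \<forall>f\<in>E. T (\<lambda>x. c * f x) = (\<lambda>y. c * T f y))"

definition continuous_linear_operator ::
    "('a \<Rightarrow> complex) set \<Rightarrow> (('a \<Rightarrow> complex) \<Rightarrow> real) set \<Rightarrow>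
     ('b \<Rightarrow> complex) set \<Rightarrow> (('b \<Rightarrow> complex) \<Rightarrow> real) set \<Rightarrow>
     (('a \<Rightarrow> complex) \<Rightarrow> ('b \<Rightarrow> complex)) \<Rightarrow> bool" where
  "continuous_linear_operator E P F Q T \<longleftrightarrow>
     linear_operator E F T \<and> continuous_map (seminorm_topology E P) (seminorm_topology F Q) T"

text \<open>
  That every member of the family is a well-defined continuous linear operator from \<open>E\<close> to \<open>F\<close>
  is part of the notion.
\<close>

definition topologizable ::
    "('a \<Rightarrow> complex) set \<Rightarrow> (('a \<Rightarrow> complex) \<Rightarrow> real) set \<Rightarrow>
     ('b \<Rightarrow> complex) set \<Rightarrow> (('b \<Rightarrow> complex) \<Rightarrow> real) set \<Rightarrow>
     'i set \<Rightarrow> ('i \<Rightarrow> ('a \<Rightarrow> complex) \<Rightarrow> ('b \<Rightarrow> complex)) \<Rightarrow> bool" where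
  "topologizable E P F Q I T \<longleftrightarrow>
     (\<forall>k\<in>I. continuous_linear_operator E P F Q (T k)) \<and>
     (\<forall>p\<in>Q. \<exists>q\<in>P. \<forall>k\<in>I. \<exists>M>0. \<forall>f\<in>E. p (T k f) \<le> M * q f)"

definition composition_operator :: "('b \<Rightarrow> 'a) \<Rightarrow> ('a \<Rightarrow> complex) \<Rightarrow> ('b \<Rightarrow> complex)" where
  "composition_operator \<psi> f = f \<circ> \<psi>"

end

(* A dilation of the weight dilates its Young conjugate: phi_sigma^*(s) = phi_omega^*(a s).  The
   iterates psi_m are again nonconstant polynomials, so one such polynomial p has to be treated,
   with the same lambda on both sides; it only influences the constant.

   By Faa di Bruno, (f o p)^(n) is a sum over k <= n of f^(k) o p with polynomial coefficients of
   size at most n!/k! (A (1 + |p|))^k, and 1 + |x| <= A (1 + |p(x)|).  The factor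
   n!/k! <= 2^n (n-k)! is at most C^n exp(lambda phi^*((n-k)/lambda)) as omega grows at most
   linearly.  Superadditivity of phi^* then bounds the weighted derivative by
   C^(n+q) exp(lambda phi^*(2(n+q)/lambda)), and since a > 2, passing from 2(n+q) to a(n+q)
   absorbs the geometric factor. *)

theory Submission
  imports Defs "HOL-Computational_Algebra.Formal_Power_Series"
begin

unbundle no vec_syntax and fps_syntax

section \<open>Growth comparison of real polynomials\<close>

text \<open>Induction strips one factor of the variable from both polynomials. Since
  \<open>q\<close> is arbitrary in the induction, the hypothesis serves twice: for the tail of
  \<open>q\<close>, and for the identity polynomial, which shows that a nonconstant tail of
  \<open>p\<close> stays away from 0 far out.\<close>

lemma poly_le_one_plus_abs_poly:
  fixes p q :: "real poly"
  assumes "degree q \<le> degree p"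
  shows "\<exists>A\<ge>0. \<forall>x. \<bar>poly q x\<bar> \<le> A * (1 + \<bar>poly p x\<bar>)"
  using assms
proof (induction p arbitrary: q)
  case 0
  then obtain e where "q = [:e:]" using degree_eq_zeroE by auto
  then show ?case by (intro exI[of _ "\<bar>e\<bar>"]) auto
next
  case (pCons c p)
  show ?case
  proof (cases "p = 0")
    case True
    then obtain e where "q = [:e:]" using degree_eq_zeroE pCons.prems by auto
    then show ?thesis by (intro exI[of _ "\<bar>e\<bar>"]) (auto simp: algebra_simps)
  next
    case False
    obtain e q' where q: "q = pCons e q'" by (cases q) auto
    have "degree q' \<le> degree p"
      using pCons.prems False q by (auto split: if_splits)
    from pCons.IH[OF this] obtain A
      where A: "A \<ge> 0" "\<And>x. \<bar>poly q' x\<bar> \<le> A * (1 + \<bar>poly p x\<bar>)" by blast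
    obtain R d where R: "R \<ge> 0" "d > 0" "\<And>x. \<bar>x\<bar> \<ge> R \<Longrightarrow> \<bar>poly p x\<bar> \<ge> d"
    proof (cases "degree p = 0")
      case True
      then obtain u where "p = [:u:]" by (rule degree_eq_zeroE)
      then show ?thesis using False that[of 0 "\<bar>u\<bar>"] by auto
    next
      case deg: False
      from pCons.IH[of "[:0, 1:]"] deg obtain B
        where B: "B \<ge> 0" "\<And>x. \<bar>x\<bar> \<le> B * (1 + \<bar>poly p x\<bar>)" by auto
      \<comment> \<open>A value below 1 in modulus would force
        \<open>\<bar>x\<bar> \<le> 2 * B\<close>.\<close>
      have "\<bar>poly p x\<bar> \<ge> 1" if "\<bar>x\<bar> \<ge> 2 * B + 1" for x
      proof (rule ccontr)
        assume "\<not> ?thesis"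
        then have "B * (1 + \<bar>poly p x\<bar>) \<le> B * 2"
          using B(1) by (intro mult_left_mono) auto
        then show False using B(2)[of x] that by auto
      qed
      then show ?thesis using that[of "2 * B + 1" 1] B by auto
    qed
    \<comment> \<open>This absorbs the bare \<open>\<bar>x\<bar>\<close> that arises when the bound
      on \<open>q'\<close> is multiplied by \<open>x\<close>; what remains is
      \<open>x * poly p x\<close>, which is \<open>poly (pCons c p) x - c\<close>.\<close>
    have x_le: "\<bar>x\<bar> \<le> R + \<bar>x * poly p x\<bar> / d" for x
    proof (cases "\<bar>x\<bar> \<ge> R")
      case True
      from R(3)[OF this] have "\<bar>x\<bar> * d \<le> \<bar>x * poly p x\<bar>"
        by (simp add: abs_mult mult_left_mono)
      then show ?thesis using R by (simp add: field_simps add_increasing)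
    next
      case False
      then show ?thesis using R by (simp add: add_increasing2)
    qed
    let ?z = "\<lambda>x. \<bar>x * poly p x\<bar>"
    have "\<bar>poly q x\<bar> \<le> (\<bar>e\<bar> + A * R + A * (1 / d + 1) * (1 + \<bar>c\<bar>)) * (1 + \<bar>poly (pCons c p) x\<bar>)" for x
    proof -
      let ?w = "1 + \<bar>poly (pCons c p) x\<bar>"
      have w: "?w \<ge> 1" by simp
      have z: "?z x \<le> (1 + \<bar>c\<bar>) * ?w"
      proof -
        have "?z x \<le> \<bar>poly (pCons c p) x\<bar> + \<bar>c\<bar> * 1" by simp
        also have "\<dots> \<le> ?w + \<bar>c\<bar> * ?w" using w by (intro add_mono mult_left_mono) auto
        finally show ?thesis by (simp add: algebra_simps)
      qed
      have "\<bar>poly q x\<bar> \<le> \<bar>e\<bar> + \<bar>x\<bar> * \<bar>poly q' x\<bar>"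
        unfolding q by (simp flip: abs_mult)
      also have "\<dots> \<le> \<bar>e\<bar> + \<bar>x\<bar> * (A * (1 + \<bar>poly p x\<bar>))"
        using A by (intro add_left_mono mult_left_mono) auto
      also have "\<dots> = \<bar>e\<bar> + A * (\<bar>x\<bar> + ?z x)" by (simp add: algebra_simps abs_mult)
      also have "\<dots> \<le> \<bar>e\<bar> + A * (R + ?z x / d + ?z x)"
        using x_le[of x] A by (intro add_left_mono mult_left_mono) auto
      also have "\<dots> = (\<bar>e\<bar> + A * R) * 1 + A * (1 / d + 1) * ?z x" by (simp add: algebra_simps)
      also have "\<dots> \<le> (\<bar>e\<bar> + A * R) * ?w + A * (1 / d + 1) * ((1 + \<bar>c\<bar>) * ?w)"
        using A R w z by (intro add_mono mult_left_mono) auto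
      finally show ?thesis by (simp add: algebra_simps)
    qed
    moreover have "\<bar>e\<bar> + A * R + A * (1 / d + 1) * (1 + \<bar>c\<bar>) \<ge> 0" using A R by simp
    ultimately show ?thesis by blast
  qed
qed

section \<open>The polynomials of Faa di Bruno's formula by generating series\<close>

definition taylor_increment :: "real poly \<Rightarrow> real poly fps" where
  "taylor_increment p = Abs_fps (\<lambda>j. if j = 0 then 0 else smult (1 / fact j) ((pderiv ^^ j) p))"

text \<open>
  The Taylor increment is \<open>p (x + h) - p x\<close> as a power series in \<open>h\<close>; the coefficient of
  \<open>h ^ n / n!\<close> in its \<open>k\<close>-th power, divided by \<open>k!\<close>, is the partial Bell polynomial
  evaluated at the derivatives of \<open>p\<close>.
\<close>

definition bell_poly :: "real poly \<Rightarrow> nat \<Rightarrow> nat \<Rightarrow> real poly" where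
  "bell_poly p n k = smult (fact n / fact k) ((taylor_increment p ^ k) $ n)"

text \<open>For series in h whose coefficients are polynomials in x, this is the partial derivative
  in x; \<open>fps_deriv\<close> is the one in h.\<close>

definition fps_pderiv :: "real poly fps \<Rightarrow> real poly fps" where
  "fps_pderiv F = Abs_fps (\<lambda>n. pderiv (F $ n))"

lemma fps_pderiv_mult: "fps_pderiv (F * G) = fps_pderiv F * G + F * fps_pderiv G"
  unfolding fps_pderiv_def
  by (rule fps_ext) (simp add: fps_mult_nth higher_pderiv_sum[of 1, simplified] pderiv_mult sum.distrib
      add.commute mult.commute[of "pderiv _"])

lemma fps_pderiv_power:
  "fps_pderiv (F ^ Suc k) = of_nat (Suc k) * F ^ k * fps_pderiv F"
proof (induction k)
  case 0
  then show ?case by simp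
next
  case (Suc k)
  have "fps_pderiv (F ^ Suc (Suc k)) = fps_pderiv F * F ^ Suc k + F * fps_pderiv (F ^ Suc k)"
    by (metis fps_pderiv_mult power_Suc)
  then show ?case unfolding Suc.IH by (simp add: algebra_simps)
qed

text \<open>The h-derivative of p(x + h) - p(x) is p'(x + h), and its x-derivative is p'(x + h) -
  p'(x).\<close>

lemma fps_deriv_taylor_increment:
  "fps_deriv (taylor_increment p) = fps_const (pderiv p) + fps_pderiv (taylor_increment p)"
proof (rule fps_ext)
  fix n
  have "of_nat (Suc n) * smult (1 / fact (Suc n)) q = smult (1 / fact n) q" for q :: "real poly"
    by (simp add: of_nat_poly field_simps del: of_nat_Suc)
  then show "fps_deriv (taylor_increment p) $ n =
      (fps_const (pderiv p) + fps_pderiv (taylor_increment p)) $ n"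
    unfolding taylor_increment_def fps_pderiv_def
    by (cases n) (simp_all add: pderiv_smult del: of_nat_Suc fact_Suc)
qed

lemma fps_deriv_taylor_increment_power:
  "fps_deriv (taylor_increment p ^ Suc k) =
     of_nat (Suc k) * fps_const (pderiv p) * taylor_increment p ^ k +
     fps_pderiv (taylor_increment p ^ Suc k)"
  unfolding fps_pderiv_power fps_deriv_power
  by (simp add: fps_deriv_taylor_increment algebra_simps del: power_Suc of_nat_Suc flip: fps_of_nat)

lemma bell_poly_0_right: "bell_poly p n 0 = (if n = 0 then 1 else 0)"
  by (simp add: bell_poly_def)

text \<open>The increment has no constant term, so its k-th power starts at order k.\<close>

lemma bell_poly_eq_0: "n < k \<Longrightarrow> bell_poly p n k = 0"
  unfolding bell_poly_def
  by (simp add: startsby_zero_power_prefix taylor_increment_def)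

text \<open>This is the coefficient of \<open>h ^ n\<close> in the formula for the h-derivative of a
  power of the increment. It is the recursion that differentiating Faa di Bruno's sum once more
  demands.\<close>

lemma bell_poly_Suc_Suc:
  "bell_poly p (Suc n) (Suc k) = pderiv (bell_poly p n (Suc k)) + pderiv p * bell_poly p n k"
proof -
  let ?F = "taylor_increment p"
  have "of_nat (Suc n) * (?F ^ Suc k) $ Suc n =
      of_nat (Suc k) * (pderiv p * (?F ^ k) $ n) + pderiv ((?F ^ Suc k) $ n)"
    using arg_cong[OF fps_deriv_taylor_increment_power, of "\<lambda>G. G $ n" p k]
    by (simp add: fps_pderiv_def mult.assoc del: power_Suc of_nat_Suc flip: fps_of_nat)
  then have "smult (real (Suc n)) ((?F ^ Suc k) $ Suc n) =
      smult (real (Suc k)) (pderiv p * (?F ^ k) $ n) + pderiv ((?F ^ Suc k) $ n)"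
    by (simp add: of_nat_poly del: power_Suc of_nat_Suc)
  \<comment> \<open>The factor \<open>Suc n\<close> completes \<open>fact n\<close> to
    \<open>fact (Suc n)\<close>, and \<open>Suc k\<close> reduces \<open>fact (Suc k)\<close> to
    \<open>fact k\<close>.\<close>
  from arg_cong[OF this, of "smult (fact n / fact (Suc k))"]
  show ?thesis
    unfolding bell_poly_def
    by (simp add: pderiv_smult smult_add_right mult.commute algebra_simps del: power_Suc of_nat_Suc)
qed

section \<open>Young conjugates of weights\<close>

text \<open>A real \<open>SUP\<close> is informative only over a bounded set. Condition (\<gamma>)
  with constant \<open>1 / (\<bar>s\<bar> + 1)\<close> makes the weight beat \<open>s * t\<close>
  once \<open>exp t\<close> exceeds a threshold; below it, t itself is bounded.\<close>

lemma young_conjugate_bdd_above: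
  assumes "weight_function \<omega>"
  shows "bdd_above ((\<lambda>t. s * t - phi_weight \<omega> t) ` {0..})"
proof -
  have nonneg: "\<And>t. t \<ge> 0 \<Longrightarrow> 0 \<le> \<omega> t"
    and small: "(\<lambda>t. ln (1 + t\<^sup>2)) \<in> o[at_top](\<omega>)"
    using assms by (auto simp: weight_function_def)
  have "eventually (\<lambda>t. norm (ln (1 + t\<^sup>2)) \<le> (1 / (\<bar>s\<bar> + 1)) * norm (\<omega> t)) at_top"
    using landau_o.smallD[OF small, of "1 / (\<bar>s\<bar> + 1)"] by simp
  then obtain N where N: "\<And>t. t \<ge> N \<Longrightarrow> norm (ln (1 + t\<^sup>2)) \<le> (1 / (\<bar>s\<bar> + 1)) * norm (\<omega> t)"
    by (auto simp: eventually_at_top_linorder)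
  have "s * t - phi_weight \<omega> t \<le> \<bar>s\<bar> * \<bar>ln (max N 1)\<bar>" if t: "t \<ge> 0" for t
  proof (cases "exp t \<ge> N")
    case True
    have "t \<le> ln ((exp t)\<^sup>2)" using t by (simp add: ln_realpow)
    also have "\<dots> \<le> ln (1 + (exp t)\<^sup>2)" by (subst ln_le_cancel_iff) (auto simp: add_pos_pos)
    also have "\<dots> \<le> (1 / (\<bar>s\<bar> + 1)) * \<omega> (exp t)" using N[OF True] nonneg[of "exp t"] by simp
    finally have "t * (\<bar>s\<bar> + 1) \<le> \<omega> (exp t)" by (simp add: field_simps)
    moreover have "s * t \<le> t * (\<bar>s\<bar> + 1)" using t
      by (smt (verit) mult.commute mult_right_mono)
    moreover have "0 \<le> \<bar>s\<bar> * \<bar>ln (max N 1)\<bar>" by simp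
    ultimately show ?thesis unfolding phi_weight_def by linarith
  next
    case False
    then have "t \<le> ln (max N 1)" by (subst ln_ge_iff) auto
    then have "\<bar>s\<bar> * t \<le> \<bar>s\<bar> * \<bar>ln (max N 1)\<bar>" by (intro mult_left_mono) auto
    moreover have "s * t \<le> \<bar>s\<bar> * t" using t by (intro mult_right_mono) auto
    moreover have "phi_weight \<omega> t \<ge> 0" using nonneg by (simp add: phi_weight_def)
    ultimately show ?thesis by linarith
  qed
  then show ?thesis by (intro bdd_aboveI2) auto
qed

text \<open>For \<open>l > 0\<close> this is the Young conjugate of \<open>l * \<omega>\<close>, the
  supremum of \<open>s * t - l * \<omega> (exp t)\<close> over \<open>t \<ge> 0\<close>. It is the
  exponent in the seminorms.\<close>

definition scaled_conjugate :: "(real \<Rightarrow> real) \<Rightarrow> real \<Rightarrow> real \<Rightarrow> real" where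
  "scaled_conjugate \<omega> l s = l * young_conjugate \<omega> (s / l)"

lemma scaled_conjugate_upper:
  assumes "weight_function \<omega>" "l > 0" "t \<ge> 0"
  shows "s * t - l * \<omega> (exp t) \<le> scaled_conjugate \<omega> l s"
proof -
  have "s / l * t - phi_weight \<omega> t \<le> young_conjugate \<omega> (s / l)"
    unfolding young_conjugate_def
    by (rule cSUP_upper[OF _ young_conjugate_bdd_above[OF assms(1)]]) (use assms(3) in simp)
  then have "l * (s / l * t - phi_weight \<omega> t) \<le> l * young_conjugate \<omega> (s / l)"
    using assms(2) by (intro mult_left_mono) auto
  then show ?thesis
    using assms(2) by (simp add: scaled_conjugate_def phi_weight_def algebra_simps)
qed

lemma scaled_conjugate_least:
  assumes "l > 0" "\<And>t. t \<ge> 0 \<Longrightarrow> s * t - l * \<omega> (exp t) \<le> B"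
  shows "scaled_conjugate \<omega> l s \<le> B"
proof -
  have "young_conjugate \<omega> (s / l) \<le> B / l"
    unfolding young_conjugate_def
  proof (rule cSUP_least)
    fix t :: real assume "t \<in> {0..}"
    then have "s * t - l * \<omega> (exp t) \<le> B" using assms(2) by simp
    then have "(s * t - l * \<omega> (exp t)) / l \<le> B / l"
      using assms(1) by (intro divide_right_mono) auto
    then show "s / l * t - phi_weight \<omega> t \<le> B / l"
      using assms(1) by (simp add: phi_weight_def diff_divide_distrib)
  qed auto
  then show ?thesis using assms(1) by (simp add: scaled_conjugate_def field_simps)
qed

lemma scaled_conjugate_mono:
  assumes "weight_function \<omega>" "l > 0" "s \<le> s'"
  shows "scaled_conjugate \<omega> l s \<le> scaled_conjugate \<omega> l s'"
proof (rule scaled_conjugate_least[OF assms(2)])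
  fix t :: real assume "t \<ge> 0"
  then have "s * t \<le> s' * t" using assms(3) by (intro mult_right_mono)
  with scaled_conjugate_upper[OF assms(1,2) \<open>t \<ge> 0\<close>, of s']
  show "s * t - l * \<omega> (exp t) \<le> scaled_conjugate \<omega> l s'" by linarith
qed

text \<open>The larger of two points is a common competitor for both suprema: the weight there is
  one of the two weights, and the other is nonnegative.\<close>

lemma scaled_conjugate_superadditive:
  assumes "weight_function \<omega>" "l > 0" "s \<ge> 0" "s' \<ge> 0"
  shows "scaled_conjugate \<omega> l s + scaled_conjugate \<omega> l s' \<le> scaled_conjugate \<omega> l (s + s')"
proof -
  let ?Y = "scaled_conjugate \<omega> l"
  have *: "s * t - l * \<omega> (exp t) + (s' * t' - l * \<omega> (exp t')) \<le> ?Y (s + s')"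
    if "t \<ge> 0" "t' \<ge> 0" for t t'
  proof -
    define u where "u = max t t'"
    have "\<omega> (exp t) \<ge> 0" "\<omega> (exp t') \<ge> 0"
      using assms(1) by (auto simp: weight_function_def)
    then have "\<omega> (exp u) \<le> \<omega> (exp t) + \<omega> (exp t')" by (auto simp: u_def max_def)
    from mult_left_mono[OF this, of l] assms(2)
    have "l * \<omega> (exp u) \<le> l * \<omega> (exp t) + l * \<omega> (exp t')" by (simp add: distrib_left)
    moreover have "s * t \<le> s * u" "s' * t' \<le> s' * u"
      using assms by (auto intro!: mult_left_mono simp: u_def)
    moreover have "(s + s') * u - l * \<omega> (exp u) \<le> ?Y (s + s')"
      using scaled_conjugate_upper[OF assms(1,2), of u] that by (simp add: u_def)
    ultimately show ?thesis by (simp add: distrib_right)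
  qed
  \<comment> \<open>The suprema are taken one after the other, first over t with t' fixed.\<close>
  have "?Y s \<le> ?Y (s + s') - (s' * t' - l * \<omega> (exp t'))" if "t' \<ge> 0" for t'
    by (rule scaled_conjugate_least[OF assms(2)]) (use *[OF _ that] in \<open>smt (verit)\<close>)
  then have "?Y s' \<le> ?Y (s + s') - ?Y s"
    by (intro scaled_conjugate_least[OF assms(2)]) (smt (verit))
  then show ?thesis by linarith
qed

text \<open>This is how a geometric factor \<open>exp (b * s)\<close> is absorbed by enlarging the
  dilation. With \<open>(a - c) * u = b\<close>, a point beyond u gains \<open>b * s\<close> by
  itself; a point before u is replaced by u, which costs the constant
  \<open>l * \<omega> (exp u)\<close>.\<close>

lemma scaled_conjugate_dilate:
  assumes "weight_function \<omega>" "l > 0" "c < a" "c \<ge> 0" "b \<ge> 0"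
  shows "\<exists>K. \<forall>s\<ge>0. scaled_conjugate \<omega> l (c * s) + b * s \<le> scaled_conjugate \<omega> l (a * s) + K"
proof -
  define u where "u = b / (a - c)"
  have u: "u \<ge> 0" "b = (a - c) * u" using assms by (auto simp: u_def)
  have pos: "\<omega> (exp t) \<ge> 0" for t using assms(1) by (auto simp: weight_function_def)
  have "scaled_conjugate \<omega> l (c * s) \<le> scaled_conjugate \<omega> l (a * s) + l * \<omega> (exp u) - b * s"
    if s: "s \<ge> 0" for s
  proof (rule scaled_conjugate_least[OF assms(2)])
    fix t :: real assume t: "t \<ge> 0"
    show "c * s * t - l * \<omega> (exp t) \<le> scaled_conjugate \<omega> l (a * s) + l * \<omega> (exp u) - b * s"
    proof (cases "t \<ge> u")
      case True
      then have "(a - c) * s * u \<le> (a - c) * s * t" using s assms by (intro mult_left_mono) auto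
      then have "c * s * t + b * s \<le> a * s * t" unfolding u(2) by (simp add: algebra_simps)
      moreover have "l * \<omega> (exp u) \<ge> 0" using pos assms by simp
      ultimately show ?thesis
        using scaled_conjugate_upper[OF assms(1,2) t, of "a * s"] by linarith
    next
      case False
      then have "c * s * t \<le> c * s * u" using s assms by (intro mult_left_mono) auto
      then have "c * s * t + b * s \<le> a * s * u" unfolding u(2) by (simp add: algebra_simps)
      moreover have "l * \<omega> (exp t) \<ge> 0" using pos assms by simp
      ultimately show ?thesis
        using scaled_conjugate_upper[OF assms(1,2) u(1), of "a * s"] by linarith
    qed
  qed
  then show ?thesis by (intro exI[of _ "l * \<omega> (exp u)"]) (auto simp: algebra_simps)
qed

text \<open>Subadditivity gives linear growth along the integers, and monotonicity passes from t to
  its ceiling.\<close>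

lemma subadditive_weight_linear_bound:
  assumes "weight_function \<omega>" "subadditive_weight \<omega>" "t \<ge> 0"
  shows "\<omega> t \<le> (\<omega> 0 + \<omega> 1) * (1 + t)"
proof -
  have mono: "mono_on {0..} \<omega>" and nonneg: "\<And>t. t \<ge> 0 \<Longrightarrow> \<omega> t \<ge> 0"
    using assms(1) by (auto simp: weight_function_def)
  have *: "\<omega> (real n) \<le> \<omega> 0 + \<omega> 1 * real n" for n
  proof (induction n)
    case (Suc n)
    have "\<omega> (real n + 1) \<le> \<omega> (real n) + \<omega> 1"
      using assms(2) by (auto simp: subadditive_weight_def)
    with Suc show ?case by (simp add: algebra_simps)
  qed auto
  define n where "n = nat \<lceil>t\<rceil>"
  have n: "t \<le> real n" "real n \<le> 1 + t" using assms(3) unfolding n_def by linarith+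
  have "\<omega> t \<le> \<omega> (real n)" using mono n assms(3) by (auto intro: mono_onD)
  also have "\<dots> \<le> \<omega> 0 * 1 + \<omega> 1 * real n" using * by simp
  also have "\<dots> \<le> \<omega> 0 * (1 + t) + \<omega> 1 * (1 + t)"
    using n nonneg assms(3) by (intro add_mono mult_left_mono) auto
  finally show ?thesis by (simp add: algebra_simps)
qed

text \<open>Testing the supremum at ln n compares \<open>n ^ n\<close> with the conjugate, up to
  \<open>exp (l * \<omega> n)\<close>; the linear bound on the weight makes this loss
  geometric.\<close>

lemma fact_le_exp_scaled_conjugate:
  assumes "weight_function \<omega>" "subadditive_weight \<omega>" "l > 0"
  shows "\<exists>K\<ge>0. \<forall>n. fact n \<le> exp (K * (1 + real n)) * exp (scaled_conjugate \<omega> l (real n))"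
proof -
  define K where "K = l * (\<omega> 0 + \<omega> 1) * 2"
  have nonneg: "\<And>t. t \<ge> 0 \<Longrightarrow> \<omega> t \<ge> 0" using assms(1) by (auto simp: weight_function_def)
  then have w: "\<omega> 0 + \<omega> 1 \<ge> 0" by (simp add: add_nonneg_nonneg)
  have K: "K \<ge> 0" using w assms(3) by (simp add: K_def)
  have "fact n \<le> exp (K * (1 + real n)) * exp (scaled_conjugate \<omega> l (real n))" for n
  proof -
    \<comment> \<open>The maximum keeps \<open>ln r\<close> nonnegative, hence admissible, when n is
      0.\<close>
    define r where "r = max 1 (real n)"
    have "l * \<omega> r \<le> l * ((\<omega> 0 + \<omega> 1) * (1 + r))"
      using subadditive_weight_linear_bound[OF assms(1,2), of r] assms(3)
      by (intro mult_left_mono) (auto simp: r_def)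
    also have "\<dots> \<le> l * ((\<omega> 0 + \<omega> 1) * (2 * (1 + real n)))"
      using w assms(3) by (intro mult_left_mono) (auto simp: r_def)
    finally have "l * \<omega> r \<le> K * (1 + real n)" by (simp add: K_def algebra_simps)
    moreover have "real n * ln r - l * \<omega> (exp (ln r)) \<le> scaled_conjugate \<omega> l (real n)"
      using scaled_conjugate_upper[OF assms(1,3), of "ln r" "real n"] by (simp add: r_def)
    moreover have "exp (ln r) = r" by (simp add: r_def)
    ultimately have "real n * ln r \<le> K * (1 + real n) + scaled_conjugate \<omega> l (real n)" by simp
    then have "exp (real n * ln r) \<le> exp (K * (1 + real n)) * exp (scaled_conjugate \<omega> l (real n))"
      by (simp flip: exp_add)
    moreover have "fact n \<le> exp (real n * ln r)"
    proof -
      have "fact n \<le> real n ^ n" using fact_le_power[of n, where 'a = real] by simp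
      also have "\<dots> \<le> r ^ n" by (intro power_mono) (auto simp: r_def)
      also have "\<dots> = exp (real n * ln r)" by (simp add: exp_of_nat_mult r_def)
      finally show ?thesis .
    qed
    ultimately show ?thesis by linarith
  qed
  with K show ?thesis by blast
qed

text \<open>Substitute \<open>a * t\<close> for t: \<open>\<sigma>\<close> at
  \<open>exp (a * t)\<close> is \<open>\<omega>\<close> at \<open>exp t\<close>.\<close>

lemma young_conjugate_powr:
  assumes "a > 0" "\<And>t. t \<ge> 0 \<Longrightarrow> \<sigma> t = \<omega> (t powr (1 / a))"
  shows "young_conjugate \<sigma> s = young_conjugate \<omega> (a * s)"
proof -
  have "(\<lambda>t. s * t - phi_weight \<sigma> t) ` {0..} = (\<lambda>t. a * s * t - phi_weight \<omega> t) ` {0..}"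
  proof -
    have "{0..} = (\<lambda>t. a * t) ` {0..}"
      using assms(1) by (auto intro!: image_eqI[of _ _ "_ / a"])
    moreover have "s * (a * t) - phi_weight \<sigma> (a * t) = a * s * t - phi_weight \<omega> t" for t
      using assms by (simp add: phi_weight_def powr_def)
    ultimately show ?thesis by (metis (no_types, lifting) image_cong image_image)
  qed
  then show ?thesis by (simp add: young_conjugate_def)
qed

section \<open>Size of the coefficients in Faa di Bruno's formula\<close>

text \<open>The increment has finitely many nonzero coefficients, all of degree at most that of
  \<open>p\<close>, so the sum of their moduli is at most
  \<open>A * (1 + \<bar>poly p x\<bar>)\<close>. Each Cauchy product then costs one such factor,
  whatever the index \<open>n\<close>.\<close>

lemma taylor_increment_power_bound:
  assumes "degree p > 0"
  shows "\<exists>A\<ge>1. \<forall>x. 1 + \<bar>x\<bar> \<le> A * (1 + \<bar>poly p x\<bar>) \<and>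
    (\<forall>k n. \<bar>poly ((taylor_increment p ^ k) $ n) x\<bar> \<le> (A * (1 + \<bar>poly p x\<bar>)) ^ k)"
proof -
  let ?F = "taylor_increment p"
  have deg: "degree (?F $ i) \<le> degree p" for i
    by (auto simp: taylor_increment_def degree_higher_pderiv)
  have zero: "?F $ i = 0" if "i > degree p" for i
  proof -
    have "degree ((pderiv ^^ degree p) p) = 0" by (simp add: degree_higher_pderiv)
    then have "(pderiv ^^ Suc (degree p)) p = 0" by (simp add: pderiv_eq_0_iff)
    moreover have "(pderiv ^^ i) p = (pderiv ^^ (i - Suc (degree p))) ((pderiv ^^ Suc (degree p)) p)"
      using that by (metis Suc_leI add_diff_cancel_right' comp_apply funpow_add le_add_diff_inverse2)
    ultimately show ?thesis by (simp add: taylor_increment_def)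
  qed
  obtain c where c: "\<And>i. c i \<ge> 0" "\<And>i x. \<bar>poly (?F $ i) x\<bar> \<le> c i * (1 + \<bar>poly p x\<bar>)"
    using poly_le_one_plus_abs_poly[OF deg] by metis
  obtain B where B: "B \<ge> 0" "\<And>x. \<bar>x\<bar> \<le> B * (1 + \<bar>poly p x\<bar>)"
    using poly_le_one_plus_abs_poly[of "[:0, 1:]" p] assms by auto
  \<comment> \<open>\<open>1 + B\<close> controls \<open>1 + \<bar>x\<bar>\<close>; the sum controls
    the coefficients.\<close>
  define A where "A = 1 + B + (\<Sum>i\<le>degree p. c i)"
  have A: "A \<ge> 1" "(\<Sum>i\<le>degree p. c i) \<le> A"
    using B c by (auto simp: A_def sum_nonneg add_nonneg_nonneg)
  have "1 + \<bar>x\<bar> \<le> A * (1 + \<bar>poly p x\<bar>)" for x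
  proof -
    have "1 + \<bar>x\<bar> \<le> (1 + B) * (1 + \<bar>poly p x\<bar>)" using B(2)[of x] by (simp add: algebra_simps)
    also have "\<dots> \<le> A * (1 + \<bar>poly p x\<bar>)"
      using c by (intro mult_right_mono) (auto simp: A_def sum_nonneg)
    finally show ?thesis .
  qed
  moreover have "\<bar>poly ((?F ^ k) $ n) x\<bar> \<le> (A * (1 + \<bar>poly p x\<bar>)) ^ k" for k n x
  proof (induction k arbitrary: n)
    case 0
    then show ?case by simp
  next
    case (Suc k)
    let ?w = "1 + \<bar>poly p x\<bar>"
    have "(\<Sum>i=0..n. \<bar>poly (?F $ i) x\<bar>) \<le> (\<Sum>i=0..max n (degree p). \<bar>poly (?F $ i) x\<bar>)"
      by (rule sum_mono2) auto
    also have "\<dots> = (\<Sum>i\<le>degree p. \<bar>poly (?F $ i) x\<bar>)"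
      by (rule sum.mono_neutral_right) (auto simp: zero)
    also have "\<dots> \<le> (\<Sum>i\<le>degree p. c i * ?w)" by (intro sum_mono c)
    also have "\<dots> = (\<Sum>i\<le>degree p. c i) * ?w" by (simp add: sum_distrib_right)
    also have "\<dots> \<le> A * ?w" using A by (intro mult_right_mono) auto
    finally have F: "(\<Sum>i=0..n. \<bar>poly (?F $ i) x\<bar>) \<le> A * ?w" .
    have "\<bar>poly ((?F ^ Suc k) $ n) x\<bar> = \<bar>\<Sum>i=0..n. poly (?F $ i) x * poly ((?F ^ k) $ (n - i)) x\<bar>"
      by (simp add: fps_mult_nth poly_sum)
    also have "\<dots> \<le> (\<Sum>i=0..n. \<bar>poly (?F $ i) x\<bar> * (A * ?w) ^ k)"
      by (rule order_trans[OF sum_abs]) (auto intro!: sum_mono mult_left_mono Suc.IH simp: abs_mult)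
    also have "\<dots> = (\<Sum>i=0..n. \<bar>poly (?F $ i) x\<bar>) * (A * ?w) ^ k" by (simp add: sum_distrib_right)
    also have "\<dots> \<le> (A * ?w) * (A * ?w) ^ k"
      using F A by (intro mult_right_mono) auto
    finally show ?case by simp
  qed
  ultimately show ?thesis using A(1) by blast
qed

section \<open>Higher derivatives and Faa di Bruno's formula\<close>

lemma nth_deriv_0 [simp]: "nth_deriv 0 f = f"
  and nth_deriv_Suc: "nth_deriv (Suc n) f = (\<lambda>x. vector_derivative (nth_deriv n f) (at x))"
  by (simp_all add: nth_deriv_def)

lemma smooth_has_vector_derivative:
  "smooth f \<Longrightarrow> (nth_deriv n f has_vector_derivative nth_deriv (Suc n) f x) (at x)"
  by (simp add: smooth_def nth_deriv_Suc flip: vector_derivative_works)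

lemma smoothI:
  assumes "D 0 = f" "\<And>n x. (D n has_vector_derivative D (Suc n) x) (at x)"
  shows "smooth f" and "nth_deriv n f = D n"
proof -
  show *: "nth_deriv n f = D n" for n
  proof (induction n)
    case (Suc n)
    then show ?case using vector_derivative_at[OF assms(2)] by (auto simp: nth_deriv_Suc)
  qed (simp add: assms(1))
  show "smooth f"
    unfolding smooth_def * using assms(2) by (blast intro: differentiableI_vector)
qed

lemma smooth_diff:
  assumes "smooth f" "smooth g"
  shows "smooth (\<lambda>x. f x - g x)"
    and "nth_deriv n (\<lambda>x. f x - g x) = (\<lambda>x. nth_deriv n f x - nth_deriv n g x)"
  by (rule smoothI[where D = "\<lambda>n x. nth_deriv n f x - nth_deriv n g x"];
      auto intro!: has_vector_derivative_diff smooth_has_vector_derivative assms)+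

text \<open>The claimed sums form a candidate sequence of derivatives for \<open>smoothI\<close>;
  product rule, chain rule and the recursion for \<open>bell_poly\<close> show that each is the
  derivative of its predecessor.\<close>

lemma faa_di_bruno_poly:
  assumes "smooth f"
  shows "smooth (f \<circ> poly p)"
    and "nth_deriv n (f \<circ> poly p) =
      (\<lambda>x. \<Sum>k\<le>n. poly (bell_poly p n k) x *\<^sub>R nth_deriv k f (poly p x))"
proof -
  define D where
    "D = (\<lambda>n x. \<Sum>k\<le>n. poly (bell_poly p n k) x *\<^sub>R nth_deriv k f (poly p x))"
  have 0: "D 0 = f \<circ> poly p" by (auto simp: D_def bell_poly_0_right)
  have step: "(D n has_vector_derivative D (Suc n) x) (at x)" for n x
  proof -
    let ?f = "\<lambda>k. nth_deriv k f (poly p x)"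
    let ?b = "\<lambda>k. poly (bell_poly p n k) x" and ?b' = "\<lambda>k. poly (pderiv (bell_poly p n k)) x"
    have chain: "((\<lambda>x. nth_deriv k f (poly p x)) has_vector_derivative
        poly (pderiv p) x *\<^sub>R ?f (Suc k)) (at x)" for k
      using vector_diff_chain_at[of "poly p" _ x, OF _ smooth_has_vector_derivative[OF assms, of k]]
        poly_DERIV[of p x] by (simp add: has_real_derivative_iff_has_vector_derivative o_def)
    have "(D n has_vector_derivative
        (\<Sum>k\<le>n. ?b k *\<^sub>R (poly (pderiv p) x *\<^sub>R ?f (Suc k)) + ?b' k *\<^sub>R ?f k)) (at x)"
      unfolding D_def
      by (intro has_vector_derivative_sum has_vector_derivative_scaleR chain poly_DERIV)
    moreover have "D (Suc n) x =
        (\<Sum>k\<le>n. ?b k *\<^sub>R (poly (pderiv p) x *\<^sub>R ?f (Suc k)) + ?b' k *\<^sub>R ?f k)"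
    proof -
      \<comment> \<open>The shift adds the index 0, where \<open>bell_poly p n 0\<close> is constant
        and has derivative 0. The top index \<open>Suc n\<close> then drops out because
        \<open>bell_poly p n (Suc n)\<close> vanishes.\<close>
      have "(\<Sum>k\<le>n. ?b' (Suc k) *\<^sub>R ?f (Suc k)) = (\<Sum>k\<le>Suc n. ?b' k *\<^sub>R ?f k)"
        by (subst sum.atMost_Suc_shift) (simp add: bell_poly_0_right)
      also have "\<dots> = (\<Sum>k\<le>n. ?b' k *\<^sub>R ?f k)" by (simp add: bell_poly_eq_0)
      finally have *: "(\<Sum>k\<le>n. ?b' (Suc k) *\<^sub>R ?f (Suc k)) = (\<Sum>k\<le>n. ?b' k *\<^sub>R ?f k)" .
      have "D (Suc n) x = (\<Sum>k\<le>n. poly (bell_poly p (Suc n) (Suc k)) x *\<^sub>R ?f (Suc k))"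
        unfolding D_def by (subst sum.atMost_Suc_shift) (simp add: bell_poly_0_right)
      also have "\<dots> = (\<Sum>k\<le>n. ?b k *\<^sub>R (poly (pderiv p) x *\<^sub>R ?f (Suc k))) +
          (\<Sum>k\<le>n. ?b' (Suc k) *\<^sub>R ?f (Suc k))"
        by (simp add: bell_poly_Suc_Suc algebra_simps sum.distrib)
      finally show ?thesis unfolding * by (simp add: sum.distrib)
    qed
    ultimately show ?thesis by simp
  qed
  from smoothI[of D, OF 0 step] show "smooth (f \<circ> poly p)"
    "nth_deriv n (f \<circ> poly p) =
      (\<lambda>x. \<Sum>k\<le>n. poly (bell_poly p n k) x *\<^sub>R nth_deriv k f (poly p x))"
    by (simp_all add: D_def)
qed

section \<open>Seminorms of the spaces\<close>

lemma S_term_eq: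
  "S_term \<omega> l f (x, n, q) =
     (1 + \<bar>x\<bar>) ^ q * norm (nth_deriv n f x) / exp (scaled_conjugate \<omega> l (real (n + q)))"
  by (simp add: S_term_def scaled_conjugate_def exp_minus divide_inverse)

lemma S_seminorm_upper:
  "f \<in> S_space \<omega> \<Longrightarrow> l > 0 \<Longrightarrow> S_term \<omega> l f i \<le> S_seminorm \<omega> l f"
  unfolding S_seminorm_def by (rule cSUP_upper) (auto simp: S_space_def)

lemma S_seminorm_least: "(\<And>i. S_term \<omega> l f i \<le> B) \<Longrightarrow> S_seminorm \<omega> l f \<le> B"
  unfolding S_seminorm_def by (rule cSUP_least) auto

lemma S_spaceI:
  assumes "smooth f" "\<And>l. l > 0 \<Longrightarrow> \<exists>B. \<forall>i. S_term \<omega> l f i \<le> B"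
  shows "f \<in> S_space \<omega>"
  using assms by (force simp: S_space_def bdd_above_def)

lemma S_term_nonneg: "S_term \<omega> l f i \<ge> 0"
  by (cases i) (simp add: S_term_eq)

lemma S_seminorm_nonneg: "f \<in> S_space \<omega> \<Longrightarrow> l > 0 \<Longrightarrow> S_seminorm \<omega> l f \<ge> 0"
  using S_seminorm_upper S_term_nonneg order_trans by blast

lemma norm_nth_deriv_le:
  assumes "f \<in> S_space \<omega>" "l > 0"
  shows "(1 + \<bar>x\<bar>) ^ q * norm (nth_deriv n f x) \<le>
    S_seminorm \<omega> l f * exp (scaled_conjugate \<omega> l (real (n + q)))"
  using S_seminorm_upper[OF assms, of "(x, n, q)"] by (simp add: S_term_eq pos_divide_le_eq)

lemma S_term_diff:
  assumes "smooth f" "smooth g"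
  shows "S_term \<omega> l (\<lambda>x. f x - g x) i \<le> S_term \<omega> l f i + S_term \<omega> l g i"
proof -
  obtain x n q where i: "i = (x, n, q)" by (cases i)
  have "(1 + \<bar>x\<bar>) ^ q * norm (nth_deriv n f x - nth_deriv n g x) \<le>
      (1 + \<bar>x\<bar>) ^ q * (norm (nth_deriv n f x) + norm (nth_deriv n g x))"
    by (intro mult_left_mono norm_triangle_ineq4) auto
  then show ?thesis
    unfolding i S_term_eq smooth_diff(2)[OF assms] add_divide_distrib[symmetric]
    by (intro divide_right_mono) (auto simp: algebra_simps)
qed

lemma S_space_smooth: "f \<in> S_space \<omega> \<Longrightarrow> smooth f"
  by (simp add: S_space_def)

lemma S_space_diff:
  assumes "f \<in> S_space \<omega>" "g \<in> S_space \<omega>"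
  shows "(\<lambda>x. f x - g x) \<in> S_space \<omega>"
proof (rule S_spaceI)
  note sm = assms[THEN S_space_smooth]
  show "smooth (\<lambda>x. f x - g x)" by (rule smooth_diff(1)[OF sm])
  fix l :: real assume l: "l > 0"
  show "\<exists>B. \<forall>i. S_term \<omega> l (\<lambda>x. f x - g x) i \<le> B"
    using S_term_diff[OF sm, of \<omega> l] S_seminorm_upper[OF assms(1) l] S_seminorm_upper[OF assms(2) l]
    by (intro exI[of _ "S_seminorm \<omega> l f + S_seminorm \<omega> l g"]) (meson add_mono order_trans)
qed

lemma S_seminorm_triangle:
  assumes "f \<in> S_space \<omega>" "g \<in> S_space \<omega>" "l > 0"
  shows "S_seminorm \<omega> l (\<lambda>x. f x - g x) \<le> S_seminorm \<omega> l f + S_seminorm \<omega> l g"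
  using S_term_diff[OF assms(1,2)[THEN S_space_smooth]]
    S_seminorm_upper[OF assms(1,3)] S_seminorm_upper[OF assms(2,3)]
  by (intro S_seminorm_least) (meson add_mono order_trans)

text \<open>Stated for differences because the balls generating the topology are.\<close>

lemma S_seminorm_triangle3:
  assumes "f \<in> S_space \<omega>" "g \<in> S_space \<omega>" "h \<in> S_space \<omega>" "l > 0"
  shows "S_seminorm \<omega> l (\<lambda>x. f x - h x) \<le>
    S_seminorm \<omega> l (\<lambda>x. f x - g x) + S_seminorm \<omega> l (\<lambda>x. g x - h x)"
proof -
  have eq: "S_seminorm \<omega> l (\<lambda>x. h x - g x) = S_seminorm \<omega> l (\<lambda>x. g x - h x)"
  proof -
    have "nth_deriv n (\<lambda>x. h x - g x) = (\<lambda>x. - nth_deriv n (\<lambda>x. g x - h x) x)" for n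
      using assms by (simp add: smooth_diff(2) S_space_smooth)
    then show ?thesis by (simp only: S_seminorm_def S_term_def norm_minus_cancel)
  qed
  have "(\<lambda>x. (f x - g x) - (h x - g x)) = (\<lambda>x. f x - h x)" by auto
  then show ?thesis
    using S_seminorm_triangle[OF S_space_diff[OF assms(1,2)] S_space_diff[OF assms(3,2)] assms(4)]
    by (simp only: eq)
qed

lemma S_seminorm_diff_self:
  assumes "f \<in> S_space \<omega>"
  shows "S_seminorm \<omega> l (\<lambda>x. f x - f x) = 0"
proof -
  have "nth_deriv n (\<lambda>x. f x - f x) = (\<lambda>x. 0)" for n
    using smooth_diff(2)[of f f] assms by (simp add: S_space_smooth)
  then show ?thesis by (simp add: S_seminorm_def S_term_def case_prod_unfold)
qed

section \<open>The estimate for composition with one polynomial\<close>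

lemma fact_div_fact_le: "k \<le> n \<Longrightarrow> fact n / fact k \<le> 2 ^ n * (fact (n - k) :: real)"
proof -
  assume "k \<le> n"
  then have "fact n / fact k = real (n choose k) * fact (n - k)"
    by (simp add: binomial_fact)
  also have "real (n choose k) \<le> 2 ^ n"
    using binomial_le_pow2[of n k] by (metis of_nat_le_iff of_nat_numeral of_nat_power)
  finally show ?thesis by (simp add: mult_right_mono)
qed

lemma weighted_deriv_comp_poly_bound:
  assumes \<omega>: "weight_function \<omega>" "subadditive_weight \<omega>" and "degree p > 0" "a > 2" "l > 0"
  shows "\<exists>M>0. \<forall>f\<in>S_space \<omega>. \<forall>x n q.
    (1 + \<bar>x\<bar>) ^ q * norm (nth_deriv n (f \<circ> poly p) x) \<le>
      M * S_seminorm \<omega> l f * exp (scaled_conjugate \<omega> l (a * real (n + q)))"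
proof -
  let ?Y = "scaled_conjugate \<omega> l"
  obtain A where A: "A \<ge> 1"
    and x_le: "\<And>x. 1 + \<bar>x\<bar> \<le> A * (1 + \<bar>poly p x\<bar>)"
    and power_le: "\<And>x k n. \<bar>poly ((taylor_increment p ^ k) $ n) x\<bar> \<le> (A * (1 + \<bar>poly p x\<bar>)) ^ k"
    using taylor_increment_power_bound[OF assms(3)] by blast
  obtain K where K: "K \<ge> 0" "\<And>n. fact n \<le> exp (K * (1 + real n)) * exp (?Y (real n))"
    using fact_le_exp_scaled_conjugate[OF \<omega> assms(5)] by blast
  \<comment> \<open>\<open>exp b\<close> is the total geometric rate: \<open>A\<close> from the
    polynomial bounds, one factor 2 from \<open>fact n / fact k\<close>, another from the number of
    summands, and \<open>exp K\<close> from the factorial.\<close>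
  define b where "b = ln (4 * A * exp K)"
  have "4 * A * exp K \<ge> 1 * exp 0" using A K by (intro mult_mono) auto
  then have b: "b \<ge> 0" "exp b = 4 * A * exp K" using A by (auto simp: b_def ln_ge_zero)
  obtain K' where K': "\<And>s. s \<ge> 0 \<Longrightarrow> ?Y (2 * s) + b * s \<le> ?Y (a * s) + K'"
    using scaled_conjugate_dilate[OF \<omega>(1) assms(5,4), of b] b by auto
  have "(1 + \<bar>x\<bar>) ^ q * norm (nth_deriv n (f \<circ> poly p) x) \<le>
      exp (K + K') * S_seminorm \<omega> l f * exp (?Y (a * real (n + q)))"
    if f: "f \<in> S_space \<omega>" for f x n q
  proof -
    let ?w = "1 + \<bar>poly p x\<bar>" and ?S = "S_seminorm \<omega> l f"
    let ?f = "\<lambda>k. norm (nth_deriv k f (poly p x))"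
    define c where "c = A ^ (n + q) * 2 ^ n * exp (K * (1 + real n)) * exp (?Y (2 * real (n + q)))"
    have S: "?S \<ge> 0" using S_seminorm_nonneg[OF f assms(5)] .
    have term_le: "(1 + \<bar>x\<bar>) ^ q * (\<bar>poly (bell_poly p n k) x\<bar> * ?f k) \<le> c * ?S" if "k \<le> n" for k
    proof -
      have "(1 + \<bar>x\<bar>) ^ q * (\<bar>poly (bell_poly p n k) x\<bar> * ?f k) \<le>
          (A * ?w) ^ q * ((fact n / fact k * (A * ?w) ^ k) * ?f k)"
        using A unfolding bell_poly_def
        by (intro mult_mono power_mono x_le)
          (auto simp: abs_mult intro!: divide_right_mono mult_left_mono power_le)
      also have "\<dots> = A ^ (k + q) * (fact n / fact k) * (?w ^ (k + q) * ?f k)"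
        by (simp add: power_mult_distrib power_add)
      \<comment> \<open>The powers of \<open>?w\<close> from the weight and from the Bell polynomial
        combine to \<open>k + q\<close>, so \<open>f\<close> is measured at \<open>poly p x\<close>
        with derivative order k and weight power \<open>k + q\<close>. Hence the argument
        \<open>k + (k + q)\<close>.\<close>
      also have "\<dots> \<le> A ^ (n + q) * (2 ^ n * (exp (K * (1 + real n)) * exp (?Y (real (n - k))))) *
          (?S * exp (?Y (real (k + (k + q)))))"
      proof (rule mult_mono[OF mult_mono norm_nth_deriv_le[OF f assms(5)]])
        show "A ^ (k + q) \<le> A ^ (n + q)" using A that by (intro power_increasing) auto
        have "K * (1 + real (n - k)) \<le> K * (1 + real n)"
          using K by (intro mult_left_mono) auto
        then have "exp (K * (1 + real (n - k))) * exp (?Y (real (n - k))) \<le>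
            exp (K * (1 + real n)) * exp (?Y (real (n - k)))"
          by (intro mult_right_mono) auto
        with K(2)[of "n - k"]
        have "fact (n - k) \<le> exp (K * (1 + real n)) * exp (?Y (real (n - k)))" by linarith
        then show "fact n / fact k \<le> 2 ^ n * (exp (K * (1 + real n)) * exp (?Y (real (n - k))))"
          using fact_div_fact_le[OF that] by (smt (verit) mult_left_mono zero_le_power)
      qed (use A in auto)
      also have "\<dots> = A ^ (n + q) * 2 ^ n * exp (K * (1 + real n)) *
          exp (?Y (real (n - k)) + ?Y (real (k + (k + q)))) * ?S"
        by (simp add: exp_add)
      also have "\<dots> \<le> c * ?S"
      proof -
        have "?Y (real (n - k)) + ?Y (real (k + (k + q))) \<le> ?Y (real (n - k) + real (k + (k + q)))"
          by (rule scaled_conjugate_superadditive[OF \<omega>(1) assms(5)]) auto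
        \<comment> \<open>The arguments add up to \<open>n + k + q\<close>, and
          \<open>k \<le> n\<close>; this is the source of the factor 2.\<close>
        also have "\<dots> \<le> ?Y (2 * real (n + q))"
          using that by (intro scaled_conjugate_mono[OF \<omega>(1) assms(5)]) auto
        finally show ?thesis
          unfolding c_def using A S by (intro mult_right_mono mult_left_mono) auto
      qed
      finally show ?thesis .
    qed
    have "(1 + \<bar>x\<bar>) ^ q * norm (nth_deriv n (f \<circ> poly p) x) \<le>
        (1 + \<bar>x\<bar>) ^ q * (\<Sum>k\<le>n. \<bar>poly (bell_poly p n k) x\<bar> * ?f k)"
      unfolding faa_di_bruno_poly(2)[OF S_space_smooth[OF f]]
      by (intro mult_left_mono order_trans[OF norm_sum]) auto
    also have "\<dots> = (\<Sum>k\<le>n. (1 + \<bar>x\<bar>) ^ q * (\<bar>poly (bell_poly p n k) x\<bar> * ?f k))"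
      by (simp add: sum_distrib_left)
    also have "\<dots> \<le> (\<Sum>k\<le>n. c * ?S)" by (intro sum_mono term_le) auto
    also have "\<dots> = real (Suc n) * (c * ?S)" by simp
    also have "\<dots> \<le> 2 ^ n * (c * ?S)"
    proof (rule mult_right_mono)
      show "real (Suc n) \<le> 2 ^ n"
        using Suc_leI[OF less_exp[of n]] by (metis of_nat_le_iff of_nat_numeral of_nat_power)
    qed (use S A in \<open>simp add: c_def\<close>)
    also have "\<dots> = (2 ^ n * c) * ?S" by simp
    \<comment> \<open>All bases are at least 1, so exponents n may be raised to
      \<open>n + q\<close>; the lone \<open>exp K\<close> comes from the 1 in
      \<open>1 + real n\<close>.\<close>
    also have "2 ^ n * c \<le> exp K * exp (b * real (n + q)) * exp (?Y (2 * real (n + q)))"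
    proof -
      have "2 ^ n * (A ^ (n + q) * 2 ^ n * exp (K * real n)) = A ^ (n + q) * (4 ^ n * exp (K * real n))"
        by (simp flip: power_mult_distrib)
      also have "\<dots> \<le> A ^ (n + q) * (4 ^ (n + q) * exp (K * real (n + q)))"
        using A K by (intro mult_mono power_increasing) (auto intro!: mult_left_mono)
      also have "\<dots> = exp b ^ (n + q)"
        unfolding b(2) by (simp add: power_mult_distrib exp_of_nat_mult[symmetric] mult.commute)
      also have "\<dots> = exp (b * real (n + q))" by (simp add: exp_of_nat_mult[symmetric] mult.commute)
      finally have "2 ^ n * (A ^ (n + q) * 2 ^ n * exp (K * real n)) *
          (exp K * exp (?Y (2 * real (n + q)))) \<le>
          exp (b * real (n + q)) * (exp K * exp (?Y (2 * real (n + q))))"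
        by (intro mult_right_mono) auto
      then show ?thesis by (simp add: c_def distrib_left exp_add mult_ac)
    qed
    also have "\<dots> \<le> exp (K + K') * exp (?Y (a * real (n + q)))"
      using K'[of "real (n + q)"] by (simp flip: exp_add)
    finally show ?thesis using S by (simp add: mult_ac mult_right_mono)
  qed
  then show ?thesis by (intro exI[of _ "exp (K + K')"]) auto
qed

section \<open>Continuity from seminorm estimates\<close>

lemma continuous_map_S_spaces:
  assumes T: "T ` S_space \<omega> \<subseteq> S_space \<sigma>"
    and lin: "\<And>f g. f \<in> S_space \<omega> \<Longrightarrow> g \<in> S_space \<omega> \<Longrightarrow> T (\<lambda>x. f x - g x) = (\<lambda>y. T f y - T g y)"
    and bound: "\<And>l. l > 0 \<Longrightarrow>
      \<exists>l'>0. \<exists>M>0. \<forall>f\<in>S_space \<omega>. S_seminorm \<sigma> l (T f) \<le> M * S_seminorm \<omega> l' f"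
  shows "continuous_map (seminorm_topology (S_space \<omega>) (S_seminorms \<omega>))
    (seminorm_topology (S_space \<sigma>) (S_seminorms \<sigma>)) T"
proof -
  let ?E = "S_space \<omega>" and ?F = "S_space \<sigma>"
  let ?TE = "seminorm_topology ?E (S_seminorms \<omega>)"
  have ball_open: "openin ?TE {g \<in> ?E. S_seminorm \<omega> l (\<lambda>x. g x - f x) < e}"
    if "f \<in> ?E" "l > 0" "e > 0" for f l e
    unfolding seminorm_topology_def
    by (rule topology_generated_by_Basis) (use that in \<open>auto simp: S_seminorms_def\<close>)
  \<comment> \<open>A generated topology lives on the union of its generators; every function lies
    in the unit ball around itself.\<close>
  have cover: "\<Union> {{g \<in> S_space \<tau>. p (\<lambda>x. g x - f x) < e} | f p e.
      f \<in> S_space \<tau> \<and> p \<in> S_seminorms \<tau> \<and> e > 0} = S_space \<tau>" (is "\<Union> ?B = _") for \<tau>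
  proof (intro equalityI subsetI)
    fix f assume f: "f \<in> S_space \<tau>"
    have "{g \<in> S_space \<tau>. S_seminorm \<tau> 1 (\<lambda>x. g x - f x) < 1} \<in> ?B"
      using f by (auto simp: S_seminorms_def intro!: exI[of _ f] exI[of _ "1::real"])
    moreover have "f \<in> {g \<in> S_space \<tau>. S_seminorm \<tau> 1 (\<lambda>x. g x - f x) < 1}"
      using f S_seminorm_diff_self[OF f] by simp
    ultimately show "f \<in> \<Union> ?B" by blast
  qed auto
  have top: "topspace (seminorm_topology (S_space \<tau>) (S_seminorms \<tau>)) = S_space \<tau>" for \<tau>
    unfolding seminorm_topology_def topology_generated_by_topspace by (rule cover)
  have "openin ?TE (T -` {g \<in> ?F. S_seminorm \<sigma> l (\<lambda>x. g x - h x) < e} \<inter> ?E)"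
    if h: "h \<in> ?F" and l: "l > 0" and e: "e > 0" for h l e
  proof (subst openin_subopen, intro ballI)
    fix f assume f: "f \<in> T -` {g \<in> ?F. S_seminorm \<sigma> l (\<lambda>x. g x - h x) < e} \<inter> ?E"
    then have fE: "f \<in> ?E" and fe: "S_seminorm \<sigma> l (\<lambda>x. T f x - h x) < e" by auto
    obtain l' M where lM: "l' > 0" "M > 0"
      and M: "\<And>g. g \<in> ?E \<Longrightarrow> S_seminorm \<sigma> l (T g) \<le> M * S_seminorm \<omega> l' g"
      using bound[OF l] by blast
    \<comment> \<open>The radius is chosen so that \<open>M * r\<close> is exactly the room left
      between the image of \<open>f\<close> and the boundary of the target ball.\<close>
    define r where "r = (e - S_seminorm \<sigma> l (\<lambda>x. T f x - h x)) / M"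
    let ?U = "{g \<in> ?E. S_seminorm \<omega> l' (\<lambda>x. g x - f x) < r}"
    have r: "r > 0" using fe lM by (simp add: r_def)
    have "openin ?TE ?U" by (rule ball_open[OF fE lM(1) r])
    moreover have "f \<in> ?U" using fE S_seminorm_diff_self[OF fE] r by simp
    moreover have "?U \<subseteq> T -` {g \<in> ?F. S_seminorm \<sigma> l (\<lambda>x. g x - h x) < e} \<inter> ?E"
    proof
      fix g assume g: "g \<in> ?U"
      then have gE: "g \<in> ?E" by simp
      have "S_seminorm \<sigma> l (\<lambda>x. T g x - h x) \<le>
          S_seminorm \<sigma> l (\<lambda>x. T g x - T f x) + S_seminorm \<sigma> l (\<lambda>x. T f x - h x)"
        using T gE fE h l by (intro S_seminorm_triangle3) auto
      also have "S_seminorm \<sigma> l (\<lambda>x. T g x - T f x) \<le> M * S_seminorm \<omega> l' (\<lambda>x. g x - f x)"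
        using M[OF S_space_diff[OF gE fE]] lin[OF gE fE] by simp
      also have "M * S_seminorm \<omega> l' (\<lambda>x. g x - f x) < M * r"
        using g lM by simp
      also have "M * r = e - S_seminorm \<sigma> l (\<lambda>x. T f x - h x)" using lM by (simp add: r_def)
      finally show "g \<in> T -` {g \<in> ?F. S_seminorm \<sigma> l (\<lambda>x. g x - h x) < e} \<inter> ?E"
        using T gE by auto
    qed
    ultimately show "\<exists>V. openin ?TE V \<and> f \<in> V \<and>
        V \<subseteq> T -` {g \<in> ?F. S_seminorm \<sigma> l (\<lambda>x. g x - h x) < e} \<inter> ?E"
      by blast
  qed
  then show ?thesis
    unfolding seminorm_topology_def[of ?F] continuous_on_generated_topo_iff top cover
    using T by (auto simp: S_seminorms_def)
qed

section \<open>Iterates and topologizability\<close>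

lemma poly_funpow:
  fixes p :: "'a :: idom poly"
  shows "\<exists>r. poly r = poly p ^^ m \<and> degree r = degree p ^ m"
proof (induction m)
  case 0
  then show ?case by (intro exI[of _ "[:0, 1:]"]) auto
next
  case (Suc m)
  then obtain r where "poly r = poly p ^^ m" "degree r = degree p ^ m" by blast
  then show ?case
    by (intro exI[of _ "pcompose p r"]) (auto simp: poly_pcompose degree_pcompose)
qed

theorem theorem2p1:
  fixes \<omega> \<sigma> :: "real \<Rightarrow> real" and \<psi> :: "real poly" and a :: real
  assumes "weight_function \<omega>"
    and "subadditive_weight \<omega>"
    and "degree \<psi> > 1"
    and "a > 2"
    and "\<And>t. t \<ge> 0 \<Longrightarrow> \<sigma> t = \<omega> (t powr (1 / a))"
  shows "topologizable (S_space \<omega>) (S_seminorms \<omega>) (S_space \<sigma>) (S_seminorms \<sigma>)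
           {m::nat. m \<ge> 1} (\<lambda>m. composition_operator (poly \<psi> ^^ m))"
proof -
  let ?C = "\<lambda>m. composition_operator (poly \<psi> ^^ m)"
  \<comment> \<open>This turns the right-hand exponent of the one-polynomial estimate into the
    exponent of the target seminorm with the same \<open>l\<close>.\<close>
  have conj: "scaled_conjugate \<sigma> l s = scaled_conjugate \<omega> l (a * s)" for l s
    using young_conjugate_powr[of a \<sigma> \<omega>] assms(4,5) by (simp add: scaled_conjugate_def)
  have term_bound: "\<exists>M>0. \<forall>f\<in>S_space \<omega>. \<forall>i. S_term \<sigma> l (?C m f) i \<le> M * S_seminorm \<omega> l f"
    if l: "l > 0" for l m
  proof -
    obtain r where r: "poly r = poly \<psi> ^^ m" "degree r = degree \<psi> ^ m"
      using poly_funpow by blast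
    then have "degree r > 0" using assms(3) by simp
    from weighted_deriv_comp_poly_bound[OF assms(1,2) this assms(4) l] show ?thesis
      by (simp add: composition_operator_def r(1) S_term_eq conj pos_divide_le_eq)
  qed
  have maps: "?C m ` S_space \<omega> \<subseteq> S_space \<sigma>" for m
  proof (intro image_subsetI S_spaceI)
    fix f assume f: "f \<in> S_space \<omega>"
    obtain r where "poly r = poly \<psi> ^^ m" using poly_funpow by blast
    then show "smooth (?C m f)"
      using faa_di_bruno_poly(1)[OF S_space_smooth[OF f], of r] by (simp add: composition_operator_def)
    show "\<exists>B. \<forall>i. S_term \<sigma> l (?C m f) i \<le> B" if "l > 0" for l
      using term_bound[OF that, of m] f by blast
  qed
  \<comment> \<open>The source seminorm is fixed by \<open>l\<close> before m enters, and only
    \<open>M\<close> depends on m; this is the order of quantifiers in topologizability.\<close>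
  have bound: "\<exists>M>0. \<forall>f\<in>S_space \<omega>. S_seminorm \<sigma> l (?C m f) \<le> M * S_seminorm \<omega> l f"
    if "l > 0" for l m
    using term_bound[OF that, of m] S_seminorm_least by meson
  have "continuous_linear_operator (S_space \<omega>) (S_seminorms \<omega>) (S_space \<sigma>) (S_seminorms \<sigma>) (?C m)" for m
    unfolding continuous_linear_operator_def linear_operator_def
  proof (intro conjI maps continuous_map_S_spaces)
    show "\<exists>l'>0. \<exists>M>0. \<forall>f\<in>S_space \<omega>. S_seminorm \<sigma> l (?C m f) \<le> M * S_seminorm \<omega> l' f"
      if "l > 0" for l
      using bound that by blast
  qed (auto simp: composition_operator_def)
  then show ?thesis
    unfolding topologizable_def using bound by (auto simp: S_seminorms_def)
qed

end
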